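(* Let $\lambda$ be a nonzero real number. For every integer $n\ge 0$, \[ \beta_{n,\lambda}=\sum_{k=0}^{n}(-1)^{k}k!\,{n \brace k}_{\lambda}\frac{\binom{k-\lambda}{k}}{k+1}. \]
   Context: For $x$ and an integer $n\ge0$, set $(x)_{0,\lambda}=1$, $(x)_{n,\lambda}=x(x-\lambda)\cdots(x-(n-1)\lambda)$ for $n\ge1$, and $(x)_0=1$, $(x)_n=x(x-1)\cdots(x-n+1)$ for $n\ge1$. The degenerate exponential is the power series $e_{\lambda}^{x}(t)=\sum_{k\ge0}(x)_{k,\lambda}\frac{t^k}{k!}$ (so $e_\lambda^x(t)=(1+\lambda t)^{x/\lambda}$), and $e_\lambda(t)=e_\lambda^1(t)$. The degenerate Stirling numbers of the second kind ${n \brace k}_{\lambda}$ are defined by $(x)_{n,\lambda}=\sum_{k=0}^{n}{n \brace k}_{\lambda}(x)_{k}$ for $n\ge0$; equivalently $\frac{1}{k!}(e_\lambda(t)-1)^k=\sum_{n\ge k}{n \brace k}_\lambda\frac{t^n}{n!}$. The degenerate Bernoulli numbers $\beta_{n,\lambda}$ are defined by $\frac{t}{e_{\lambda}(t)-1}=\sum_{n\ge0}\beta_{n,\lambda}\frac{t^{n}}{n!}$. Here $\binom{k-\lambda}{k}=(k-\lambda)_k/k!$. *)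

theory Defs
  imports Complex_Main "HOL-Computational_Algebra.Formal_Power_Series"
begin

definition falling_fact :: "real \<Rightarrow> nat \<Rightarrow> real" where
  "falling_fact x n = (\<Prod>i<n. x - real i)"

definition degen_falling_fact :: "real \<Rightarrow> real \<Rightarrow> nat \<Rightarrow> real" where
  "degen_falling_fact l x n = (\<Prod>i<n. x - real i * l)"

definition degen_exp :: "real \<Rightarrow> real \<Rightarrow> real fps" where
  "degen_exp l x = Abs_fps (\<lambda>k. degen_falling_fact l x k / fact k)"

text \<open>Row \<open>n\<close> of the degenerate Stirling numbers of the second kind is the coefficient
  sequence of the degenerate falling factorial in the basis of ordinary falling factorials.
  The sequence is extended by \<open>0\<close> beyond \<open>n\<close> so that the definite description is unique; see
  \<open>ex1_degen_Stirling2_row\<close> below for its existence and uniqueness.\<close>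

definition is_degen_Stirling2_row :: "real \<Rightarrow> nat \<Rightarrow> (nat \<Rightarrow> real) \<Rightarrow> bool" where
  "is_degen_Stirling2_row l n c \<longleftrightarrow>
     (\<forall>x. degen_falling_fact l x n = (\<Sum>k\<le>n. c k * falling_fact x k)) \<and> (\<forall>k>n. c k = 0)"

definition degen_Stirling2 :: "real \<Rightarrow> nat \<Rightarrow> nat \<Rightarrow> real" where
  "degen_Stirling2 l n = (THE c. is_degen_Stirling2_row l n c)"

text \<open>The quotient is division of formal power series: \<open>degen_exp l 1 - 1\<close> has subdegree 1, so
  the common factor \<open>fps_X\<close> cancels and the quotient is exact; see \<open>degen_bernoulli_gf\<close>.\<close>

definition degen_bernoulli :: "real \<Rightarrow> nat \<Rightarrow> real" where
  "degen_bernoulli l n = fact n * fps_nth (fps_X / (degen_exp l 1 - 1)) n"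

lemma falling_fact_coeffs_unique:
  assumes eq: "\<And>x. (\<Sum>k\<le>n. c k * falling_fact x k) = (\<Sum>k\<le>n. d k * falling_fact x k)"
    and "k \<le> n"
  shows "c k = d k"
  using \<open>k \<le> n\<close>
proof (induction k rule: less_induct)
  case (less k)
  have zero: "falling_fact (real k) j = 0" if "j > k" for j
    using that unfolding falling_fact_def by (intro prod_zero) auto
  have pos: "falling_fact (real k) k > 0"
    unfolding falling_fact_def by (intro prod_pos) auto
  have split: "(\<Sum>j\<le>n. f j * falling_fact (real k) j)
      = (\<Sum>j<k. f j * falling_fact (real k) j) + f k * falling_fact (real k) k"
    for f :: "nat \<Rightarrow> real"
  proof -
    have "(\<Sum>j\<le>n. f j * falling_fact (real k) j) = (\<Sum>j\<le>k. f j * falling_fact (real k) j)"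
      using less.prems by (intro sum.mono_neutral_right) (auto simp: zero)
    then show ?thesis
      by (simp flip: lessThan_Suc_atMost)
  qed
  have "(\<Sum>j<k. c j * falling_fact (real k) j) = (\<Sum>j<k. d j * falling_fact (real k) j)"
    using less by (intro sum.cong) auto
  with eq[of "real k"] pos show ?case
    by (simp add: split)
qed

lemma ex_degen_Stirling2_row: "\<exists>c. is_degen_Stirling2_row l n c"
proof (induction n)
  case 0
  show ?case
    by (rule exI[of _ "\<lambda>k. if k = 0 then 1 else 0"])
       (simp add: is_degen_Stirling2_row_def degen_falling_fact_def falling_fact_def)
next
  case (Suc n)
  then obtain c where c: "\<And>x. degen_falling_fact l x n = (\<Sum>k\<le>n. c k * falling_fact x k)"
      and c0: "\<And>k. k > n \<Longrightarrow> c k = 0"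
    by (auto simp: is_degen_Stirling2_row_def)
  define d where "d k = (if k = 0 then 0 else c (k - 1)) + (real k - real n * l) * c k" for k
  have "degen_falling_fact l x (Suc n) = (\<Sum>k\<le>Suc n. d k * falling_fact x k)" for x
  proof -
    have "degen_falling_fact l x (Suc n) = (\<Sum>k\<le>n. c k * falling_fact x k) * (x - real n * l)"
      by (simp add: c[symmetric] degen_falling_fact_def)
    also have "\<dots> = (\<Sum>k\<le>n. c k * falling_fact x (Suc k))
        + (\<Sum>k\<le>n. (real k - real n * l) * c k * falling_fact x k)"
      unfolding sum_distrib_right sum.distrib[symmetric]
      by (intro sum.cong) (simp_all add: falling_fact_def algebra_simps)
    also have "(\<Sum>k\<le>n. c k * falling_fact x (Suc k))
        = (\<Sum>k\<le>Suc n. (if k = 0 then 0 else c (k - 1)) * falling_fact x k)"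
      by (subst sum.atMost_Suc_shift) simp
    also have "(\<Sum>k\<le>n. (real k - real n * l) * c k * falling_fact x k)
        = (\<Sum>k\<le>Suc n. (real k - real n * l) * c k * falling_fact x k)"
      by (simp add: c0)
    finally show ?thesis
      by (simp only: d_def sum.distrib distrib_right)
  qed
  moreover have "d k = 0" if "k > Suc n" for k
    using that c0[of k] c0[of "k - 1"] by (simp add: d_def)
  ultimately show ?case
    by (auto simp: is_degen_Stirling2_row_def)
qed

lemma ex1_degen_Stirling2_row: "\<exists>!c. is_degen_Stirling2_row l n c"
proof (rule ex_ex1I[OF ex_degen_Stirling2_row])
  fix c d
  assume c: "is_degen_Stirling2_row l n c" and d: "is_degen_Stirling2_row l n d"
  show "c = d"
  proof (intro ext)
    fix k
    show "c k = d k"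
    proof (cases "k \<le> n")
      case True
      show ?thesis
        by (rule falling_fact_coeffs_unique[OF _ True])
           (use c d in \<open>unfold is_degen_Stirling2_row_def, metis\<close>)
    next
      case False
      then show ?thesis
        using c d by (simp add: is_degen_Stirling2_row_def)
    qed
  qed
qed

lemma degen_falling_fact_eq_Stirling2:
  "degen_falling_fact l x n = (\<Sum>k\<le>n. degen_Stirling2 l n k * falling_fact x k)"
proof -
  have "is_degen_Stirling2_row l n (degen_Stirling2 l n)"
    unfolding degen_Stirling2_def by (rule theI'[OF ex1_degen_Stirling2_row])
  then show ?thesis
    unfolding is_degen_Stirling2_row_def by blast
qed

lemma degen_bernoulli_gf:
  "Abs_fps (\<lambda>n. degen_bernoulli l n / fact n) * (degen_exp l 1 - 1) = fps_X"
proof -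
  let ?g = "degen_exp l 1 - 1"
  have 0: "fps_nth ?g 0 = 0" and 1: "fps_nth ?g 1 = 1"
    by (simp_all add: degen_exp_def degen_falling_fact_def)
  have "subdegree ?g = 1"
    using 0 1 by (intro subdegreeI) auto
  moreover from 1 have "?g \<noteq> 0"
    by (metis fps_zero_nth zero_neq_one)
  ultimately have "?g dvd fps_X"
    by (simp add: fps_dvd_iff)
  moreover have "Abs_fps (\<lambda>n. degen_bernoulli l n / fact n) = fps_X / ?g"
    by (simp add: fps_eq_iff degen_bernoulli_def)
  ultimately show ?thesis
    by simp
qed

end

theory Submission
  imports Defs
begin

text \<open>Put \<open>g = e\<^sub>\<lambda>(t) - 1\<close>. Both \<open>(1 + g)\<^sup>x\<close> and \<open>e\<^sub>\<lambda>\<^sup>x(t)\<close> solve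
  \<open>(1 + \<lambda>t) F' = x F\<close>, \<open>F(0) = 1\<close>, so they are equal. Comparing coefficients of \<open>(x)\<^sub>k\<close> gives
  the generating function \<open>g\<^sup>k / k!\<close> of the Stirling numbers, and \<open>x = \<lambda>\<close> gives
  \<open>(1 + g)\<^sup>\<lambda> = 1 + \<lambda>t\<close>. Dividing the binomial expansion of \<open>\<lambda>t = (1 + g)\<^sup>\<lambda> - 1\<close> by
  \<open>\<lambda>g\<close> expands \<open>t / g\<close> in powers of \<open>g\<close>.\<close>

lemma gbinomial_eq_falling_fact: "x gchoose k = falling_fact x k / fact k"
  by (simp add: gbinomial_prod_rev falling_fact_def atLeast0LessThan)

lemma degen_exp_nth_0 [simp]: "fps_nth (degen_exp l x) 0 = 1"
  by (simp add: degen_exp_def degen_falling_fact_def)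

text \<open>Turns the differential equation into a first-order recurrence on coefficients.\<close>

lemma fps_nth_degen_ODE_lhs:
  "fps_nth ((1 + fps_const l * fps_X) * fps_deriv F) n
    = real (Suc n) * fps_nth F (Suc n) + real n * l * fps_nth F n"
  by (cases n) (simp_all add: distrib_left distrib_right mult_ac)

lemma degen_exp_ODE:
  "(1 + fps_const l * fps_X) * fps_deriv (degen_exp l x) = fps_const x * degen_exp l x"
proof (rule fps_ext)
  fix n
  have "real (Suc n) * fps_nth (degen_exp l x) (Suc n) = (x - real n * l) * fps_nth (degen_exp l x) n"
    by (simp add: degen_exp_def degen_falling_fact_def del: of_nat_Suc)
  then show "fps_nth ((1 + fps_const l * fps_X) * fps_deriv (degen_exp l x)) n
      = fps_nth (fps_const x * degen_exp l x) n"
    unfolding fps_nth_degen_ODE_lhs by (simp add: left_diff_distrib del: of_nat_Suc)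
qed

text \<open>The recurrence fixes each coefficient from the one before, since
  \<open>real (Suc n)\<close> can be cancelled.\<close>

lemma degen_exp_unique:
  assumes ode: "(1 + fps_const l * fps_X) * fps_deriv F = fps_const x * F"
    and "fps_nth F 0 = 1"
  shows "F = degen_exp l x"
proof (rule fps_ext)
  have rec: "real (Suc n) * fps_nth G (Suc n) = (x - real n * l) * fps_nth G n"
    if "(1 + fps_const l * fps_X) * fps_deriv G = fps_const x * G" for G n
    using fps_nth_degen_ODE_lhs[of l G n] unfolding that
    by (simp add: left_diff_distrib del: of_nat_Suc)
  show "fps_nth F n = fps_nth (degen_exp l x) n" for n
  proof (induction n)
    case 0
    then show ?case
      using assms(2) by simp
  next
    case (Suc n)
    have "real (Suc n) * fps_nth F (Suc n) = real (Suc n) * fps_nth (degen_exp l x) (Suc n)"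
      by (simp only: rec[OF ode] rec[OF degen_exp_ODE] Suc.IH)
    then show ?case
      by (simp del: of_nat_Suc)
  qed
qed

text \<open>Lets the binomial series inherit its differential equation from
  \<open>degen_exp_ODE\<close>.\<close>

lemma fps_binomial_eq_degen_exp: "fps_binomial x = degen_exp 1 x"
  by (rule fps_ext)
    (simp add: degen_exp_def degen_falling_fact_def gbinomial_prod_rev atLeast0LessThan)

lemma fps_binomial_compose_degen_exp:
  "fps_binomial x oo (degen_exp l 1 - 1) = degen_exp l x"
proof (rule degen_exp_unique)
  let ?g = "degen_exp l 1 - 1"
  let ?H = "fps_binomial x oo ?g"
  have g0: "fps_nth ?g 0 = 0"
    by simp
  have "(1 + fps_X) * fps_deriv (fps_binomial x) = fps_const x * fps_binomial x"
    using degen_exp_ODE[of 1 x] by (simp add: fps_binomial_eq_degen_exp)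
  then have "((1 + fps_X) * fps_deriv (fps_binomial x)) oo ?g = (fps_const x * fps_binomial x) oo ?g"
    by simp
  \<comment> \<open>Substituting \<open>?g\<close> for \<open>fps_X\<close> turns
    \<open>1 + fps_X\<close> into \<open>degen_exp l 1\<close>.\<close>
  then have B: "degen_exp l 1 * (fps_deriv (fps_binomial x) oo ?g) = fps_const x * ?H"
    by (simp add: fps_compose_mult_distrib[OF g0] fps_compose_add_distrib)
  have "(1 + fps_const l * fps_X) * fps_deriv ?H
      = (fps_deriv (fps_binomial x) oo ?g) * ((1 + fps_const l * fps_X) * fps_deriv (degen_exp l 1))"
    by (simp add: fps_compose_deriv[OF g0] mult_ac)
  \<comment> \<open>The equation for \<open>degen_exp l 1\<close> replaces the chain rule factor by
    \<open>degen_exp l 1\<close> itself, so \<open>B\<close> applies.\<close>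
  also have "\<dots> = fps_const x * ?H"
    unfolding degen_exp_ODE using B by (simp add: mult.commute)
  finally show "(1 + fps_const l * fps_X) * fps_deriv ?H = fps_const x * ?H" .
qed simp

lemma degen_exp_self: "degen_exp l l = 1 + fps_const l * fps_X"
  by (rule degen_exp_unique[symmetric]) (simp_all add: mult.commute)

text \<open>Both sides, divided by \<open>fact k\<close>, are coefficients of
  \<open>degen_falling_fact l x n\<close> in the basis of falling factorials, and these are
  unique.\<close>

lemma degen_Stirling2_gf:
  assumes "k \<le> n"
  shows "fact k * degen_Stirling2 l n k = fact n * fps_nth ((degen_exp l 1 - 1) ^ k) n"
proof -
  let ?g = "degen_exp l 1 - 1"
  have "degen_Stirling2 l n k = fact n * fps_nth (?g ^ k) n / fact k"
  proof (rule falling_fact_coeffs_unique[OF _ assms])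
    fix x
    have "(\<Sum>k\<le>n. degen_Stirling2 l n k * falling_fact x k) = fact n * fps_nth (degen_exp l x) n"
      by (simp add: degen_falling_fact_eq_Stirling2 degen_exp_def)
    also have "fps_nth (degen_exp l x) n = (\<Sum>k\<le>n. (x gchoose k) * fps_nth (?g ^ k) n)"
      by (subst fps_binomial_compose_degen_exp[symmetric]) (simp add: fps_compose_nth atLeast0AtMost)
    also have "fact n * \<dots> = (\<Sum>k\<le>n. fact n * fps_nth (?g ^ k) n / fact k * falling_fact x k)"
      by (simp add: sum_distrib_left gbinomial_eq_falling_fact mult_ac)
    finally show "(\<Sum>k\<le>n. degen_Stirling2 l n k * falling_fact x k)
        = (\<Sum>k\<le>n. fact n * fps_nth (?g ^ k) n / fact k * falling_fact x k)" .
  qed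
  then show ?thesis
    by simp
qed

text \<open>The outer series is ((1 + X)^l - 1) / (l X).\<close>

lemma degen_bernoulli_gf_compose:
  assumes "l \<noteq> 0"
  shows "Abs_fps (\<lambda>n. degen_bernoulli l n / fact n)
    = Abs_fps (\<lambda>k. ((l - 1) gchoose k) / (real k + 1)) oo (degen_exp l 1 - 1)"
    (is "?B = ?A oo ?g")
proof -
  have g0: "fps_nth ?g 0 = 0"
    by simp
  have "fps_const l * (fps_X * ?A) = fps_binomial l - 1"
  proof (rule fps_ext)
    show "fps_nth (fps_const l * (fps_X * ?A)) n = fps_nth (fps_binomial l - 1) n" for n
      \<comment> \<open>Absorption matters for \<open>n = Suc k\<close>, where \<open>n - 1\<close>
        is \<open>k\<close>; at \<open>n = 0\<close> both coefficients vanish.\<close>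
      using gbinomial_absorption[of "n - 1" l]
      by (cases n) (simp_all add: field_simps)
  qed
  then have "(fps_const l * (fps_X * ?A)) oo ?g = (fps_binomial l - 1) oo ?g"
    by simp
  then have "fps_const l * (?g * (?A oo ?g)) = fps_const l * fps_X"
    by (simp add: fps_compose_mult_distrib[OF g0] fps_compose_sub_distrib
        fps_binomial_compose_degen_exp degen_exp_self)
  then have X: "(?A oo ?g) * ?g = fps_X"
    using assms by (simp add: mult.commute)
  then have "?g \<noteq> 0"
    by auto
  \<comment> \<open>Both series give \<open>fps_X\<close> when multiplied by the nonzero
    \<open>?g\<close>, which cancels.\<close>
  then show ?thesis
    using X degen_bernoulli_gf[of l] by (metis mult_right_cancel)
qed

theorem theorem2p1:
  fixes l :: real and n :: nat
  assumes "l \<noteq> 0"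
  shows "degen_bernoulli l n =
    (\<Sum>k=0..n. (-1) ^ k * fact k * degen_Stirling2 l n k *
       (((real k - l) gchoose k) / (real k + 1)))"
proof -
  have "degen_bernoulli l n
      = fact n * fps_nth (Abs_fps (\<lambda>n. degen_bernoulli l n / fact n)) n"
    by simp
  also have "\<dots> = (\<Sum>k=0..n. ((l - 1) gchoose k) / (real k + 1)
      * (fact n * fps_nth ((degen_exp l 1 - 1) ^ k) n))"
    unfolding degen_bernoulli_gf_compose[OF assms]
    by (simp add: fps_compose_nth sum_distrib_left mult_ac)
  also have "\<dots> = (\<Sum>k=0..n. (-1) ^ k * fact k * degen_Stirling2 l n k *
       (((real k - l) gchoose k) / (real k + 1)))"
  proof (rule sum.cong)
    fix k assume "k \<in> {0..n}"
    then show "((l - 1) gchoose k) / (real k + 1) * (fact n * fps_nth ((degen_exp l 1 - 1) ^ k) n)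
        = (-1) ^ k * fact k * degen_Stirling2 l n k * (((real k - l) gchoose k) / (real k + 1))"
      \<comment> \<open>Negating the upper index sends \<open>l - 1\<close> to k - (l - 1) - 1 = k -
        l and produces the sign.\<close>
      using gbinomial_negated_upper[of "l - 1" k]
      by (simp flip: degen_Stirling2_gf)
  qed simp
  finally show ?thesis .
qed

end
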